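(* Let $n$ be a positive integer and let $D_1\subseteq[n-1]$ and $D_2\subseteq[n-1]$. Then (1) $$\sum_{\{\pi\in S_n\,:\,\mathrm{Des}_S(\pi^{-1})\subseteq D_1,\ \mathrm{Del}_S(\pi^{-1})\subseteq D_2\}} q^{\mathrm{rmaj}_{S_n}(\pi)}=\sum_{\{\pi\in S_n\,:\,\mathrm{Des}_S(\pi^{-1})\subseteq D_1,\ \mathrm{Del}_S(\pi^{-1})\subseteq D_2\}} q^{\ell_S(\pi)},$$ and (2) $$\sum_{\{\sigma\in A_{n+1}\,:\,\mathrm{Des}_A(\sigma^{-1})\subseteq D_1,\ \mathrm{Del}_A(\sigma^{-1})\subseteq D_2\}} q^{\mathrm{rmaj}_{A_{n+1}}(\sigma)}=\sum_{\{\sigma\in A_{n+1}\,:\,\mathrm{Des}_A(\sigma^{-1})\subseteq D_1,\ \mathrm{Del}_A(\sigma^{-1})\subseteq D_2\}} q^{\ell_A(\sigma)}.$$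
   Context: $[m]=\{1,\dots,m\}$. Permutations are written in one-line notation $\pi=[\pi(1),\dots,\pi(n)]$ and multiplied as functions: $(\sigma\tau)(k)=\sigma(\tau(k))$; $s_i=(i,i+1)$. Symmetric group statistics: $\mathrm{Des}_S(\pi)=\{i\in[n-1]:\pi(i)>\pi(i+1)\}$; $\mathrm{rmaj}_{S_n}(\pi)=\sum_{i\in\mathrm{Des}_S(\pi)}(n-i)$; $\ell_S(\pi)$ is the number of inversions of $\pi$ (pairs $i<j$ with $\pi(i)>\pi(j)$); $\mathrm{Del}_S(w)=\{1<i\le n:\ w(i)<w(j)\text{ for all }j<i\}$ (left-to-right minima other than position 1). Alternating group: in $S_{n+1}$ put $a_i=s_1s_{i+1}=(1,2)(i+1,i+2)$ for $1\le i\le n-1$. For $1\le j\le n-1$ let $R^A_j=\{1,\ a_j,\ a_ja_{j-1},\ \dots,\ a_j\cdots a_2,\ a_j\cdots a_2a_1,\ a_j\cdots a_2a_1^{-1}\}$ (so $R^A_1=\{1,a_1,a_1^{-1}\}$), each element regarded as the displayed word. Every $v\in A_{n+1}$ has a unique factorization $v=v_1\cdots v_{n-1}$ with $v_j\in R^A_j$ (the $A$ canonical presentation); $\ell_A(v)$ is the total number of letters $a_i^{\pm1}$ in this word. $\mathrm{Des}_A(\sigma)=\{1\le i\le n-1:\ \ell_A(\sigma)\ge\ell_A(\sigma a_i)\}$ and $\mathrm{rmaj}_{A_{n+1}}(\sigma)=\sum_{i\in\mathrm{Des}_A(\sigma)}(n-i)$. For $w\in A_{n+1}$ (one-line notation $[b_1,\dots,b_{n+1}]$),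 $\mathrm{Del}_A(w)$ is the set of positions $i$ with $3\le i\le n+1$ such that $|\{j<i: b_j<b_i\}|\le 1$. *)

theory Defs
  imports "HOL-Combinatorics.Permutations" "HOL-Computational_Algebra.Polynomial"
begin

(* Permutations of [m] are functions nat => nat with "permutes {1..m}"; since these fix every
   point outside [m], the size is an explicit parameter of the statistics. *)

definition sym_perms :: "nat \<Rightarrow> (nat \<Rightarrow> nat) set" where
  "sym_perms m = {p. p permutes {1..m}}"

definition alt_perms :: "nat \<Rightarrow> (nat \<Rightarrow> nat) set" where
  "alt_perms m = {p. p permutes {1..m} \<and> evenperm p}"

definition Des_S :: "nat \<Rightarrow> (nat \<Rightarrow> nat) \<Rightarrow> nat set" where
  "Des_S n p = {i \<in> {1..n - 1}. p i > p (i + 1)}"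

definition rmaj_S :: "nat \<Rightarrow> (nat \<Rightarrow> nat) \<Rightarrow> nat" where
  "rmaj_S n p = (\<Sum>i\<in>Des_S n p. n - i)"

definition ell_S :: "nat \<Rightarrow> (nat \<Rightarrow> nat) \<Rightarrow> nat" where
  "ell_S n p = card {(i, j). 1 \<le> i \<and> i < j \<and> j \<le> n \<and> p i > p j}"

definition Del_S :: "nat \<Rightarrow> (nat \<Rightarrow> nat) \<Rightarrow> nat set" where
  "Del_S n w = {i. 1 < i \<and> i \<le> n \<and> (\<forall>j\<in>{1..<i}. w i < w j)}"

definition gen_s :: "nat \<Rightarrow> nat \<Rightarrow> nat" where
  "gen_s i = transpose i (i + 1)"

definition gen_a :: "nat \<Rightarrow> nat \<Rightarrow> nat" where
  "gen_a i = gen_s 1 \<circ> gen_s (i + 1)"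

(* A letter (i, True) stands for a_i, and (i, False) for its inverse. *)

type_synonym A_word = "(nat \<times> bool) list"

definition letter_perm :: "nat \<times> bool \<Rightarrow> nat \<Rightarrow> nat" where
  "letter_perm x = (if snd x then gen_a (fst x) else inv (gen_a (fst x)))"

definition word_perm :: "A_word \<Rightarrow> nat \<Rightarrow> nat" where
  "word_perm w = foldr (\<lambda>x p. letter_perm x \<circ> p) w id"

definition desc_word :: "nat \<Rightarrow> nat \<Rightarrow> A_word" where
  "desc_word j k = map (\<lambda>i. (i, True)) (rev [k..<j + 1])"

(* desc_word j k is the word a_j a_(j-1) ... a_k, which is empty for k = j + 1. *)

definition R_A :: "nat \<Rightarrow> A_word set" where
  "R_A j = {desc_word j k | k. 1 \<le> k \<and> k \<le> j + 1} \<union> {desc_word j 2 @ [(1, False)]}"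

(* List positions start at 0, so ws ! j is the factor v_(j+1). *)

definition A_presentation :: "nat \<Rightarrow> (nat \<Rightarrow> nat) \<Rightarrow> A_word list \<Rightarrow> bool" where
  "A_presentation n v ws \<longleftrightarrow>
     length ws = n - 1 \<and> (\<forall>j<n - 1. ws ! j \<in> R_A (j + 1)) \<and> word_perm (concat ws) = v"

(* Meaningful for v in alt_perms (n + 1), where the presentation exists and is unique. *)

definition ell_A :: "nat \<Rightarrow> (nat \<Rightarrow> nat) \<Rightarrow> nat" where
  "ell_A n v = length (concat (THE ws. A_presentation n v ws))"

definition Des_A :: "nat \<Rightarrow> (nat \<Rightarrow> nat) \<Rightarrow> nat set" where
  "Des_A n p = {i \<in> {1..n - 1}. ell_A n p \<ge> ell_A n (p \<circ> gen_a i)}"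

definition rmaj_A :: "nat \<Rightarrow> (nat \<Rightarrow> nat) \<Rightarrow> nat" where
  "rmaj_A n p = (\<Sum>i\<in>Des_A n p. n - i)"

definition Del_A :: "nat \<Rightarrow> (nat \<Rightarrow> nat) \<Rightarrow> nat set" where
  "Del_A n w = {i \<in> {3..n + 1}. card {j \<in> {1..<i}. w j < w i} \<le> 1}"

end

theory Submission
  imports Defs "HOL-Combinatorics.Multiset_Permutations"
begin

text \<open>
  Part (1): Foata's second fundamental transformation, read from the left, maps the word \<open>x w\<close> to
  \<open>x\<close> followed by the image of \<open>w\<close> in which the blocks determined by \<open>x\<close> are rotated. A rotation
  changes neither the subword of letters below \<open>x\<close> nor that of the other letters, so the bijection
  preserves the relative order of \<open>i\<close> and \<open>i + 1\<close> and the set of left-to-right minima, which encode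
  \<open>Des_S\<close> and \<open>Del_S\<close> of the inverse, while it turns \<open>rmaj\<close> into the inversion number.

  Part (2): one pass of bubble sort, carrying the current minimum to the right, followed by deleting
  the final entry 1 and lowering all others by 1, is a map from \<open>S(n+1)\<close> to \<open>S(n)\<close>. It commutes with
  inversion and takes the \<open>A\<close>-statistics to the \<open>S\<close>-statistics (with \<open>Del\<close> shifted by 1). Its fibre
  in \<open>A(n+1)\<close> over \<open>p\<close> has \<open>2 ^ card (Del_S n (inv p))\<close> elements, so (2) is a weighted form of (1).
\<close>

subsection \<open>Statistics of words\<close>

fun inversions :: "'a::linorder list \<Rightarrow> nat" where
  "inversions [] = 0"
| "inversions (x # w) = length (filter (\<lambda>y. y < x) w) + inversions w"

fun rmaj :: "'a::linorder list \<Rightarrow> nat" where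
  "rmaj [] = 0"
| "rmaj (x # w) = (if w \<noteq> [] \<and> hd w < x then length w else 0) + rmaj w"

fun before :: "'a list \<Rightarrow> ('a \<times> 'a) set" where
  "before [] = {}"
| "before (x # w) = {x} \<times> set w \<union> before w"

definition inv_descents :: "nat list \<Rightarrow> nat set" where
  "inv_descents w = {i. (Suc i, i) \<in> before w}"

definition lr_minima :: "'a::linorder list \<Rightarrow> 'a set" where
  "lr_minima w = {x \<in> set w. \<forall>y\<in>set w. y < x \<longrightarrow> (x, y) \<in> before w}"

lemma before_subset: "before w \<subseteq> set w \<times> set w"
  by (induction w) auto

lemma before_append: "before (v @ w) = before v \<union> set v \<times> set w \<union> before w"
  by (induction v) auto

lemma before_map: "before (map f w) = map_prod f f ` before w"
  by (induction w) auto

lemma before_filter: "before (filter P w) = before w \<inter> Collect P \<times> Collect P"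
  by (induction w) auto

lemma inversions_eq_card_before:
  assumes "distinct w"
  shows "inversions w = card {(x, y) \<in> before w. y < x}"
  using assms
proof (induction w)
  case (Cons x w)
  let ?I = "{(x, y) \<in> before w. y < x}" and ?J = "{y \<in> set w. y < x}"
  have "{(x', y) \<in> before (x # w). y < x'} = Pair x ` ?J \<union> ?I" by auto
  moreover have "finite ?I"
    by (rule finite_subset[of _ "set w \<times> set w"]) (use before_subset[of w] in auto)
  moreover have "Pair x ` ?J \<inter> ?I = {}" using Cons.prems before_subset[of w] by auto
  moreover have "length (filter (\<lambda>y. y < x) w) = card ?J"
    using Cons.prems distinct_card[of "filter (\<lambda>y. y < x) w"] by simp
  ultimately show ?case using Cons by (simp add: card_Un_disjoint card_image inj_on_def)
qed simp

lemma rmaj_eq_sum_descents: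
  "rmaj w = (\<Sum>i | Suc i < length w \<and> w ! Suc i < w ! i. length w - Suc i)"
proof (induction w)
  case (Cons x w)
  let ?D = "\<lambda>w. {i. Suc i < length w \<and> w ! Suc i < w ! i}"
  have D: "?D (x # w) = (if w \<noteq> [] \<and> hd w < x then {0} else {}) \<union> Suc ` ?D w"
  proof (rule set_eqI)
    show "i \<in> ?D (x # w) \<longleftrightarrow> i \<in> (if w \<noteq> [] \<and> hd w < x then {0} else {}) \<union> Suc ` ?D w" for i
      by (cases i) (auto simp: hd_conv_nth)
  qed
  have "finite (?D w)" by (rule finite_subset[of _ "{..<length w}"]) auto
  then show ?case unfolding D using Cons by (simp add: sum.reindex)
qed simp

lemma lr_minima_subset: "lr_minima w \<subseteq> set w"
  by (auto simp: lr_minima_def)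

lemma lr_minima_Cons:
  "x \<notin> set w \<Longrightarrow> lr_minima (x # w) = insert x {y \<in> lr_minima w. y < x}"
  using before_subset[of w] by (auto simp: lr_minima_def)

lemma lr_minima_snoc:
  "x \<notin> set w \<Longrightarrow>
    lr_minima (w @ [x]) = lr_minima w \<union> (if \<forall>y\<in>set w. x < y then {x} else {})"
  using before_subset[of w] by (auto simp: lr_minima_def before_append)

lemma lr_minima_filter_less: "lr_minima (filter (\<lambda>y. y < x) w) = {y \<in> lr_minima w. y < x}"
  by (auto simp: lr_minima_def before_filter)

lemma lr_minima_map:
  assumes "strict_mono f"
  shows "lr_minima (map f w) = f ` lr_minima w"
proof -
  have "(f x, f y) \<in> before (map f w) \<longleftrightarrow> (x, y) \<in> before w" for x y
    using strict_mono_eq[OF assms] by (auto simp: before_map)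
  then show ?thesis
    using strict_mono_less[OF assms] by (auto simp: lr_minima_def)
qed

lemma inv_descents_Cons:
  "inv_descents (x # w) = {i. Suc i = x \<and> i \<in> set w} \<union> inv_descents w"
  by (auto simp: inv_descents_def)

subsection \<open>Foata's second fundamental transformation\<close>

text \<open>
  In \<open>carry P c w\<close>, the word \<open>c # w\<close> is cut before every letter satisfying \<open>P\<close>, and the first letter
  of each block is moved to the end of its block.
\<close>

fun carry :: "('a \<Rightarrow> bool) \<Rightarrow> 'a \<Rightarrow> 'a list \<Rightarrow> 'a list" where
  "carry P c [] = [c]"
| "carry P c (y # w) = (if P y then c # carry P y w else y # carry P c w)"

fun rotate_blocks :: "'a::linorder \<Rightarrow> 'a list \<Rightarrow> 'a list" where
  "rotate_blocks x [] = []"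
| "rotate_blocks x (c # w) = carry (\<lambda>y. y < x \<longleftrightarrow> c < x) c w"

fun foata :: "'a::linorder list \<Rightarrow> 'a list" where
  "foata [] = []"
| "foata (x # w) = x # rotate_blocks x (foata w)"

lemma mset_carry: "mset (carry P c w) = mset (c # w)"
  by (induction w arbitrary: c) auto

lemma length_carry [simp]: "length (carry P c w) = Suc (length w)"
  by (metis mset_carry size_mset length_Cons)

lemma length_filter_carry:
  "length (filter Q (carry P c w)) = length (filter Q (c # w))"
  by (metis mset_carry mset_filter size_mset)

lemma filter_carry: "P c \<Longrightarrow> filter P (carry P c w) = c # filter P w"
  by (induction w arbitrary: c) auto

lemma filter_not_carry: "P c \<Longrightarrow> filter (\<lambda>y. \<not> P y) (carry P c w) = filter (\<lambda>y. \<not> P y) w"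
  by (induction w arbitrary: c) auto

lemma last_carry: "P c \<Longrightarrow> P (last (carry P c w))"
proof (induction w arbitrary: c)
  case (Cons y w)
  have "carry P a w \<noteq> []" for a by (metis length_carry list.size(3) nat.distinct(1))
  then show ?case using Cons by auto
qed simp

lemma carry_inject:
  "\<lbrakk>carry P c w = carry P d v; P c; P d\<rbrakk> \<Longrightarrow> c = d \<and> w = v"
proof (induction w arbitrary: c d v)
  case Nil
  then have "length v = 0" by (metis length_carry list.size(3) nat.inject)
  with Nil show ?case by simp
next
  case (Cons y w)
  then have "length v = Suc (length w)" by (metis length_carry length_Cons nat.inject)
  then obtain z u where v: "v = z # u" by (cases v) auto
  show ?case
    using Cons.prems Cons.IH[of y z u] Cons.IH[of c d u]
    by (auto simp: v split: if_splits)
qed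

text \<open>
  In the first case every block is a letter below \<open>x\<close> followed by letters that are not, so rotating
  the blocks creates one inversion for each of the latter; in the second case it is the reverse.
\<close>

lemma inversions_carry:
  "c < x \<Longrightarrow> inversions (carry (\<lambda>y. y < x) c w) =
     inversions (c # w) + length (filter (\<lambda>y. \<not> y < x) w)"
  "\<not> c < x \<Longrightarrow> inversions (carry (\<lambda>y. \<not> y < x) c w) + length (filter (\<lambda>y. y < x) w) =
     inversions (c # w)"
  by (induction w arbitrary: c) (auto simp: length_filter_carry)

lemma mset_rotate_blocks [simp]: "mset (rotate_blocks x w) = mset w"
  by (cases w) (simp_all add: mset_carry)

lemma set_rotate_blocks [simp]: "set (rotate_blocks x w) = set w"
  by (metis mset_rotate_blocks set_mset_mset)

lemma filter_rotate_blocks: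
  "filter (\<lambda>y. y < x) (rotate_blocks x w) = filter (\<lambda>y. y < x) w"
  "filter (\<lambda>y. \<not> y < x) (rotate_blocks x w) = filter (\<lambda>y. \<not> y < x) w"
proof (atomize (full), cases w)
  case (Cons c v)
  let ?P = "\<lambda>y. y < x \<longleftrightarrow> c < x"
  show "filter (\<lambda>y. y < x) (rotate_blocks x w) = filter (\<lambda>y. y < x) w \<and>
      filter (\<lambda>y. \<not> y < x) (rotate_blocks x w) = filter (\<lambda>y. \<not> y < x) w"
    using filter_carry[of ?P c v] filter_not_carry[of ?P c v]
    by (cases "c < x") (simp_all add: Cons)
qed simp

lemma inj_rotate_blocks: "inj (rotate_blocks x)"
proof (rule injI)
  fix v w assume eq: "rotate_blocks x v = rotate_blocks x w"
  then have len: "length v = length w" by (metis mset_rotate_blocks size_mset)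
  show "v = w"
  proof (cases v)
    case Nil
    then show ?thesis using len by simp
  next
    case v: (Cons c v')
    then obtain d w' where w: "w = d # w'" using len by (cases w) auto
    have "d < x \<longleftrightarrow> c < x"
      using eq last_carry[of "\<lambda>y. y < x \<longleftrightarrow> c < x" c v'] last_carry[of "\<lambda>y. y < x \<longleftrightarrow> d < x" d w']
      by (simp add: v w)
    then show ?thesis
      using eq carry_inject[of "\<lambda>y. y < x \<longleftrightarrow> c < x" c v' d w'] by (simp add: v w)
  qed
qed

lemma inversions_rotate_blocks:
  "inversions (rotate_blocks x w) + length (filter (\<lambda>y. y < x) w) =
    inversions w + (if w \<noteq> [] \<and> hd w < x then length w else 0)"
proof (cases w)
  case (Cons c v)
  then show ?thesis
    using inversions_carry[of c x v] sum_length_filter_compl[of "\<lambda>y. y < x" v]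
    by (cases "c < x") auto
qed simp

lemma inv_descents_rotate_blocks:
  assumes "x \<notin> set w"
  shows "inv_descents (rotate_blocks x w) = inv_descents w"
proof -
  have eq: "before (rotate_blocks x w) \<inter> Collect P \<times> Collect P = before w \<inter> Collect P \<times> Collect P"
    if "P = (\<lambda>y. y < x) \<or> P = (\<lambda>y. \<not> y < x)" for P
    using that by (auto simp only: before_filter[symmetric] filter_rotate_blocks)
  have "(Suc i, i) \<in> before (rotate_blocks x w) \<longleftrightarrow> (Suc i, i) \<in> before w" for i
  proof (cases "Suc i = x")
    case True
    then show ?thesis
      using assms before_subset[of w] before_subset[of "rotate_blocks x w"] by auto
  next
    case False
    then have "Suc i < x \<longleftrightarrow> i < x" by auto
    then show ?thesis using eq[of "\<lambda>y. y < x"] eq[of "\<lambda>y. \<not> y < x"] by blast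
  qed
  then show ?thesis by (simp add: inv_descents_def)
qed

lemma lr_minima_rotate_blocks:
  "{y \<in> lr_minima (rotate_blocks x w). y < x} = {y \<in> lr_minima w. y < x}"
  by (simp only: lr_minima_filter_less[symmetric] filter_rotate_blocks)

lemma mset_foata [simp]: "mset (foata w) = mset w"
  by (induction w) simp_all

lemma set_foata [simp]: "set (foata w) = set w"
  by (metis mset_foata set_mset_mset)

lemma length_foata [simp]: "length (foata w) = length w"
  by (metis mset_foata size_mset)

lemma distinct_foata [simp]: "distinct (foata w) \<longleftrightarrow> distinct w"
  by (metis mset_foata mset_eq_imp_distinct_iff)

lemma hd_foata [simp]: "hd (foata w) = hd w"
  by (cases w) auto

lemma foata_eq_Nil_iff [simp]: "foata w = [] \<longleftrightarrow> w = []"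
  by (cases w) auto

lemma inj_foata: "inj foata"
proof (rule injI)
  show "foata v = foata w \<Longrightarrow> v = w" for v w :: "'a list"
  proof (induction v arbitrary: w)
    case Nil
    then show ?case by (cases w) auto
  next
    case (Cons x v)
    then show ?case by (cases w) (auto dest: injD[OF inj_rotate_blocks])
  qed
qed

lemma bij_betw_foata:
  assumes "finite A"
  shows "bij_betw foata (permutations_of_set A) (permutations_of_set A)"
proof (rule bij_betw_imageI)
  show "inj_on foata (permutations_of_set A)"
    using inj_foata by (rule inj_on_subset) simp
  moreover have "foata ` permutations_of_set A \<subseteq> permutations_of_set A"
    by (auto simp: permutations_of_set_def)
  ultimately show "foata ` permutations_of_set A = permutations_of_set A"
    by (simp add: endo_inj_surj)
qed

lemma inversions_foata: "inversions (foata w) = rmaj w"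
proof (induction w)
  case (Cons x w)
  have "inversions (foata (x # w)) =
      inversions (rotate_blocks x (foata w)) + length (filter (\<lambda>y. y < x) (foata w))"
    by (simp add: filter_rotate_blocks)
  also have "\<dots> = inversions (foata w) + (if w \<noteq> [] \<and> hd w < x then length w else 0)"
    by (simp add: inversions_rotate_blocks)
  finally show ?case using Cons by simp
qed simp

lemma inv_descents_foata: "distinct w \<Longrightarrow> inv_descents (foata w) = inv_descents w"
  by (induction w) (simp_all add: inv_descents_Cons inv_descents_rotate_blocks)

lemma lr_minima_foata: "distinct w \<Longrightarrow> lr_minima (foata w) = lr_minima w"
  by (induction w) (simp_all add: lr_minima_Cons lr_minima_rotate_blocks)

lemma sum_rmaj_eq_sum_inversions:
  assumes "finite A"
  shows "(\<Sum>w\<in>permutations_of_set A. F (inv_descents w) (lr_minima w) (rmaj w)) =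
         (\<Sum>w\<in>permutations_of_set A. F (inv_descents w) (lr_minima w) (inversions w))"
proof -
  have "(\<Sum>w\<in>permutations_of_set A. F (inv_descents w) (lr_minima w) (rmaj w)) =
      (\<Sum>w\<in>permutations_of_set A.
        F (inv_descents (foata w)) (lr_minima (foata w)) (inversions (foata w)))"
    by (intro sum.cong refl)
      (simp add: permutations_of_set_def inversions_foata inv_descents_foata lr_minima_foata)
  also have "\<dots> = (\<Sum>w\<in>permutations_of_set A. F (inv_descents w) (lr_minima w) (inversions w))"
    by (rule sum.reindex_bij_betw[OF bij_betw_foata[OF assms]])
  finally show ?thesis .
qed

subsection \<open>Permutations in one-line notation\<close>

definition one_line :: "nat \<Rightarrow> (nat \<Rightarrow> nat) \<Rightarrow> nat list" where
  "one_line n p = map p [1..<Suc n]"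

lemma length_one_line [simp]: "length (one_line n p) = n"
  by (simp add: one_line_def del: upt_Suc)

lemma nth_one_line [simp]: "i < n \<Longrightarrow> one_line n p ! i = p (Suc i)"
  by (simp add: one_line_def del: upt_Suc)

lemma one_line_Suc: "one_line (Suc n) p = one_line n p @ [p (Suc n)]"
  by (simp add: one_line_def)

lemma take_one_line: "k \<le> n \<Longrightarrow> take k (one_line n p) = one_line k p"
  by (simp add: list_eq_iff_nth_eq)

lemma set_one_line: "set (one_line n p) = p ` {1..n}"
  by (simp add: one_line_def atLeastLessThanSuc_atLeastAtMost del: upt_Suc)

lemma distinct_one_line: "inj p \<Longrightarrow> distinct (one_line n p)"
  unfolding one_line_def distinct_map by (auto intro: inj_on_subset)

lemma one_line_in_permutations_of_set:
  "p \<in> sym_perms n \<Longrightarrow> one_line n p \<in> permutations_of_set {1..n}"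
  by (simp add: sym_perms_def permutations_of_set_def set_one_line permutes_image
      distinct_one_line permutes_inj)

lemma finite_sym_perms: "finite (sym_perms n)"
  unfolding sym_perms_def by (rule finite_permutations) simp

lemma inj_on_one_line: "inj_on (one_line n) (sym_perms n)"
proof (intro inj_onI ext)
  fix p q i
  assume p: "p \<in> sym_perms n" and q: "q \<in> sym_perms n" and eq: "one_line n p = one_line n q"
  show "p i = q i"
  proof (cases "i \<in> {1..n}")
    case True
    then show ?thesis using eq by (auto simp: one_line_def simp del: upt_Suc)
  next
    case False
    then show ?thesis using p q by (simp add: sym_perms_def permutes_not_in)
  qed
qed

lemma bij_betw_one_line: "bij_betw (one_line n) (sym_perms n) (permutations_of_set {1..n})"
proof (rule bij_betw_imageI[OF inj_on_one_line card_subset_eq])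
  show "one_line n ` sym_perms n \<subseteq> permutations_of_set {1..n}"
    using one_line_in_permutations_of_set by blast
  show "card (one_line n ` sym_perms n) = card (permutations_of_set {1..n})"
    unfolding card_image[OF inj_on_one_line] by (simp add: sym_perms_def card_permutations[of _ n])
qed simp

lemma before_one_line: "before (one_line n p) = map_prod p p ` {(i, j). 1 \<le> i \<and> i < j \<and> j \<le> n}"
proof (induction n)
  case 0
  then show ?case by (auto simp: one_line_def)
next
  case (Suc n)
  have "{(i, j). 1 \<le> i \<and> i < j \<and> j \<le> Suc n} =
      {(i, j). 1 \<le> i \<and> i < j \<and> j \<le> n} \<union> {1..n} \<times> {Suc n}"
    by auto
  then show ?case
    using Suc
    by (simp add: one_line_Suc before_append set_one_line image_Un map_prod_surj_on[OF refl refl])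
qed

lemma before_one_line_iff:
  assumes "p permutes {1..n}" "x \<in> {1..n}" "y \<in> {1..n}"
  shows "(x, y) \<in> before (one_line n p) \<longleftrightarrow> inv p x < inv p y"
proof -
  have "inv p x \<in> {1..n}" "inv p y \<in> {1..n}"
    using assms by (simp_all only: permutes_in_image[OF permutes_inv])
  moreover have "inj p" using assms(1) by (rule permutes_inj)
  moreover have "x = p (inv p x)" "y = p (inv p y)"
    using permutes_inverses(1)[OF assms(1)] by simp_all
  ultimately show ?thesis
    unfolding before_one_line
    by (auto simp: permutes_inverses(2)[OF assms(1)] intro!: image_eqI[of _ _ "(inv p x, inv p y)"])
qed

lemma ell_S_eq_inversions:
  assumes "p permutes {1..n}"
  shows "ell_S n p = inversions (one_line n p)"
proof -
  have "{(x, y) \<in> before (one_line n p). y < x} =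
      map_prod p p ` {(i, j). 1 \<le> i \<and> i < j \<and> j \<le> n \<and> p i > p j}"
    by (auto simp: before_one_line)
  moreover have "inj (map_prod p p)" by (intro prod.inj_map permutes_inj[OF assms])
  ultimately show ?thesis
    using distinct_one_line[OF permutes_inj[OF assms]]
    by (simp add: inversions_eq_card_before ell_S_def card_image inj_on_subset)
qed

lemma rmaj_S_eq_rmaj: "rmaj_S n p = rmaj (one_line n p)"
proof -
  have "Des_S n p = Suc ` {i. Suc i < n \<and> one_line n p ! Suc i < one_line n p ! i}"
  proof (rule set_eqI)
    show "i \<in> Des_S n p \<longleftrightarrow> i \<in> Suc ` {i. Suc i < n \<and> one_line n p ! Suc i < one_line n p ! i}"
      for i by (cases i) (auto simp: Des_S_def)
  qed
  then show ?thesis by (simp add: rmaj_S_def rmaj_eq_sum_descents sum.reindex)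
qed

lemma Des_S_inv_eq_inv_descents:
  assumes p: "p permutes {1..n}"
  shows "Des_S n (inv p) = inv_descents (one_line n p)"
proof -
  have "i \<in> {1..n - 1} \<longleftrightarrow> i \<in> {1..n} \<and> Suc i \<in> {1..n}" for i by auto
  then show ?thesis
    using before_one_line_iff[OF p] before_subset[of "one_line n p"]
    unfolding set_one_line permutes_image[OF p] Des_S_def inv_descents_def by auto
qed

lemma Del_S_inv_eq_lr_minima:
  assumes p: "p permutes {1..n}"
  shows "Del_S n (inv p) = lr_minima (one_line n p) - {1}"
  using before_one_line_iff[OF p]
  unfolding Del_S_def lr_minima_def set_one_line permutes_image[OF p] by auto

lemma sum_rmaj_S_eq_sum_ell_S:
  "(\<Sum>p\<in>sym_perms n. F (Des_S n (inv p)) (Del_S n (inv p)) (rmaj_S n p)) =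
   (\<Sum>p\<in>sym_perms n. F (Des_S n (inv p)) (Del_S n (inv p)) (ell_S n p))"
proof -
  let ?G = "\<lambda>r w. F (inv_descents w) (lr_minima w - {1}) (r w)"
  have "(\<Sum>p\<in>sym_perms n. F (Des_S n (inv p)) (Del_S n (inv p)) (rmaj_S n p)) =
      (\<Sum>p\<in>sym_perms n. ?G rmaj (one_line n p))"
    by (simp add: sym_perms_def Des_S_inv_eq_inv_descents Del_S_inv_eq_lr_minima rmaj_S_eq_rmaj)
  also have "\<dots> = (\<Sum>w\<in>permutations_of_set {1..n}. ?G rmaj w)"
    by (rule sum.reindex_bij_betw[OF bij_betw_one_line])
  also have "\<dots> = (\<Sum>w\<in>permutations_of_set {1..n}. ?G inversions w)"
    using sum_rmaj_eq_sum_inversions[of "{1..n}" "\<lambda>D L. F D (L - {1})"] by simp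
  also have "\<dots> = (\<Sum>p\<in>sym_perms n. ?G inversions (one_line n p))"
    by (rule sum.reindex_bij_betw[OF bij_betw_one_line, symmetric])
  also have "\<dots> = (\<Sum>p\<in>sym_perms n. F (Des_S n (inv p)) (Del_S n (inv p)) (ell_S n p))"
    by (simp add: sym_perms_def Des_S_inv_eq_inv_descents Del_S_inv_eq_lr_minima
        ell_S_eq_inversions)
  finally show ?thesis .
qed

subsection \<open>Adjacent transpositions\<close>

lemma gen_s_apply: "gen_s i k = (if k = i then Suc i else if k = Suc i then i else k)"
  by (simp add: gen_s_def transpose_def)

lemma gen_s_permutes: "\<lbrakk>1 \<le> i; Suc i \<le> m\<rbrakk> \<Longrightarrow> gen_s i permutes {1..m}"
  unfolding gen_s_def by (intro permutes_swap_id) auto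

lemma permutes_comp_gen_s:
  "\<lbrakk>v permutes {1..m}; 1 \<le> i; Suc i \<le> m\<rbrakk> \<Longrightarrow> v \<circ> gen_s i permutes {1..m}"
  by (intro permutes_compose gen_s_permutes)

lemma gen_s_comp_gen_s [simp]: "gen_s i \<circ> gen_s i = id"
  by (auto simp: gen_s_apply)

lemma permutation_gen_s: "permutation (gen_s i)"
  by (simp add: gen_s_def permutation_swap_id)

lemma not_evenperm_gen_s: "\<not> evenperm (gen_s i)"
  by (simp add: gen_s_def evenperm_swap)

lemma ell_S_comp_gen_s:
  assumes "1 \<le> i" "i < n" "p i < p (Suc i)"
  shows "ell_S n (p \<circ> gen_s i) = Suc (ell_S n p)"
proof -
  let ?I = "\<lambda>p. {(a, b). 1 \<le> a \<and> a < b \<and> b \<le> n \<and> p a > p b}"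
  let ?s = "map_prod (gen_s i) (gen_s i)"
  have invol: "?s (?s ab) = ab" for ab by (cases ab) (auto simp: gen_s_apply)
  have "?s ab \<in> ?I p" if "ab \<in> ?I (p \<circ> gen_s i)" "ab \<noteq> (i, Suc i)" for ab
    using that assms by (cases ab) (auto simp: gen_s_apply split: if_splits)
  moreover have "?s ab \<in> ?I (p \<circ> gen_s i)" "?s ab \<noteq> (i, Suc i)" if "ab \<in> ?I p" for ab
    using that assms by (cases ab; auto simp: gen_s_apply split: if_splits)+
  moreover have "(i, Suc i) \<in> ?I (p \<circ> gen_s i)" using assms by (simp add: gen_s_apply)
  ultimately have "?I (p \<circ> gen_s i) = insert (i, Suc i) (?s ` ?I p)" "(i, Suc i) \<notin> ?s ` ?I p"
    using invol by (auto simp: image_iff) metis+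
  moreover have "finite (?I p)" by (rule finite_subset[of _ "{..n} \<times> {..n}"]) auto
  moreover have "card (?s ` ?I p) = card (?I p)"
    using invol by (intro card_image inj_on_inverseI)
  ultimately show ?thesis
    unfolding ell_S_def by (simp only: card_insert_disjoint finite_imageI simp_thms)
qed

lemma ell_S_comp_gen_s_le_iff:
  assumes "inj p" "1 \<le> i" "i < n"
  shows "ell_S n (p \<circ> gen_s i) \<le> ell_S n p \<longleftrightarrow> p (Suc i) < p i"
proof -
  have "p i \<noteq> p (Suc i)" using assms(1) by (simp add: inj_eq)
  then consider "p i < p (Suc i)" | "p (Suc i) < p i" by linarith
  then show ?thesis
  proof cases
    case 1
    then show ?thesis using ell_S_comp_gen_s[OF assms(2,3), of p] by simp
  next
    case 2
    then have "(p \<circ> gen_s i) i < (p \<circ> gen_s i) (Suc i)" by (simp add: gen_s_apply)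
    then have "ell_S n (p \<circ> gen_s i \<circ> gen_s i) = Suc (ell_S n (p \<circ> gen_s i))"
      by (rule ell_S_comp_gen_s[OF assms(2,3)])
    then show ?thesis using 2 by (simp add: comp_assoc)
  qed
qed

lemma permutes_atMost_le: "\<lbrakk>v permutes {1..m}; i \<le> m\<rbrakk> \<Longrightarrow> v i \<le> m" for m :: nat
  by (metis atLeastAtMost_iff permutes_in_image permutes_not_in)

lemma permutes_pos: "\<lbrakk>v permutes {1..m}; 1 \<le> i\<rbrakk> \<Longrightarrow> 1 \<le> v i" for m :: nat
  by (metis atLeastAtMost_iff permutes_in_image permutes_not_in)

lemma ell_S_Suc:
  assumes "p permutes {1..n}"
  shows "ell_S (Suc n) p = ell_S n p"
proof -
  have "\<not> p (Suc n) < p i" if "i \<le> n" for i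
    using permutes_atMost_le[OF assms that] permutes_not_in[OF assms, of "Suc n"] by simp
  then have "{(i, j). 1 \<le> i \<and> i < j \<and> j \<le> Suc n \<and> p j < p i} =
      {(i, j). 1 \<le> i \<and> i < j \<and> j \<le> n \<and> p j < p i}"
    by (auto simp: le_Suc_eq)
  then show ?thesis by (simp only: ell_S_def)
qed

subsection \<open>The covering map\<close>

text \<open>
  One pass of bubble sort over \<open>w\<close>, carrying the current minimum to the right; the minimum of the
  whole word, which ends up in the last position, is dropped.
\<close>

definition sweep :: "'a::linorder list \<Rightarrow> 'a list" where
  "sweep w = map (\<lambda>i. max (Min (set (take i w))) (w ! i)) [1..<length w]"

definition cover :: "(nat \<Rightarrow> nat) \<Rightarrow> nat \<Rightarrow> nat" where
  "cover v i = (if i = 0 then 0 else max (Min (v ` {1..i})) (v (Suc i)) - 1)"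

lemma length_sweep [simp]: "length (sweep w) = length w - 1"
  by (simp add: sweep_def)

lemma sweep_singleton [simp]: "sweep [x] = []"
  by (simp add: sweep_def)

lemma sweep_snoc:
  assumes "w \<noteq> []"
  shows "sweep (w @ [y]) = sweep w @ [max (Min (set w)) y]"
  using assms by (simp add: sweep_def nth_append Suc_leI)

lemma add_mset_Min_mset_sweep:
  assumes "w \<noteq> []"
  shows "add_mset (Min (set w)) (mset (sweep w)) = mset w"
  using assms
proof (induction w rule: rev_nonempty_induct)
  case (single x)
  then show ?case by simp
next
  case (snoc y w)
  then have "Min (set (w @ [y])) = min (Min (set w)) y" by (simp add: min.commute)
  then show ?case
    using snoc add_mset_commute[of y "Min (set w)"]
    by (simp add: sweep_snoc min_def max_def)
qed

lemma insert_Min_set_sweep: "w \<noteq> [] \<Longrightarrow> insert (Min (set w)) (set (sweep w)) = set w"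
  by (metis add_mset_Min_mset_sweep set_mset_add_mset_insert set_mset_mset)

lemma set_sweep:
  assumes "distinct w" "w \<noteq> []"
  shows "set (sweep w) = set w - {Min (set w)}"
proof -
  have "distinct (Min (set w) # sweep w)"
    using assms add_mset_Min_mset_sweep[of w] mset_eq_imp_distinct_iff
    by (metis mset.simps(2))
  then show ?thesis using insert_Min_set_sweep[OF assms(2)] by auto
qed

lemma sweep_one_line:
  assumes "v permutes {1..m}"
  shows "sweep (one_line (Suc n) v) = map Suc (one_line n (cover v))"
proof (rule nth_equalityI)
  fix i assume "i < length (sweep (one_line (Suc n) v))"
  then show "sweep (one_line (Suc n) v) ! i = map Suc (one_line n (cover v)) ! i"
    using permutes_pos[OF assms, of "Suc (Suc i)"]
    by (simp add: sweep_def take_one_line set_one_line cover_def del: upt_Suc)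
qed simp

lemma Suc_image_cover:
  assumes "v permutes {1..m}"
  shows "Suc ` cover v ` {1..k} = v ` {1..Suc k} - {Min (v ` {1..Suc k})}"
proof -
  have "set (sweep (one_line (Suc k) v)) = v ` {1..Suc k} - {Min (v ` {1..Suc k})}"
    using set_sweep[OF distinct_one_line[OF permutes_inj[OF assms]], of "Suc k"]
    unfolding set_one_line by (simp add: one_line_Suc)
  then show ?thesis by (simp only: sweep_one_line[OF assms] set_map set_one_line)
qed

text \<open>
  The right-hand side does not change when \<open>v\<close> is replaced by its inverse and \<open>i\<close>, \<open>j\<close> are swapped;
  this is why \<open>cover\<close> commutes with inversion.
\<close>

lemma cover_eq_iff:
  assumes v: "v permutes {1..m}" and "1 \<le> i" "1 \<le> j"
  shows "cover v i = j \<longleftrightarrow>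
    (if \<exists>k\<in>{1..i}. v k \<le> j then v (Suc i) = Suc j else v (Suc i) \<le> j \<and> inv v (Suc j) \<le> i)"
proof -
  define h where "h = Min (v ` {1..i})"
  have h_le: "h \<le> j \<longleftrightarrow> (\<exists>k\<in>{1..i}. v k \<le> j)" for j
    unfolding h_def using \<open>1 \<le> i\<close> by (subst Min_le_iff) auto
  have "cover v i = j \<longleftrightarrow> max h (v (Suc i)) = Suc j"
    using \<open>1 \<le> i\<close> \<open>1 \<le> j\<close> by (auto simp: cover_def h_def)
  also have "\<dots> \<longleftrightarrow> (if h \<le> j then v (Suc i) = Suc j else v (Suc i) \<le> j \<and> inv v (Suc j) \<le> i)"
  proof (cases "h \<le> j")
    case False
    have "h = Suc j \<longleftrightarrow> (\<exists>k\<in>{1..i}. v k = Suc j)"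
      using False h_le[of j] h_le[of "Suc j"] by (auto simp: le_Suc_eq)
    also have "\<dots> \<longleftrightarrow> inv v (Suc j) \<in> {1..i}"
      by (metis permutes_inverses[OF v])
    also have "\<dots> \<longleftrightarrow> inv v (Suc j) \<le> i"
      using permutes_pos[OF permutes_inv[OF v], of "Suc j"] by simp
    finally have h: "h = Suc j \<longleftrightarrow> inv v (Suc j) \<le> i" .
    moreover have "v (Suc i) \<noteq> Suc j" if "inv v (Suc j) \<le> i"
      using that by (metis Suc_n_not_le_n permutes_inverses(2)[OF v])
    ultimately show ?thesis using False by auto
  qed auto
  finally show ?thesis by (simp only: h_le)
qed

lemma cover_pos:
  assumes v: "v permutes {1..m}" and "1 \<le> i"
  shows "1 \<le> cover v i"
proof -
  have "Min (v ` {1..i}) \<in> v ` {1..i}" using \<open>1 \<le> i\<close> by (intro Min_in) auto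
  then obtain k where "1 \<le> k" "k \<le> i" "Min (v ` {1..i}) = v k" by auto
  moreover from this have "v k \<noteq> v (Suc i)" by (simp add: inj_eq[OF permutes_inj[OF v]])
  ultimately have "1 < max (Min (v ` {1..i})) (v (Suc i))"
    using permutes_pos[OF v, of k] permutes_pos[OF v, of "Suc i"] by simp
  then show ?thesis using \<open>1 \<le> i\<close> by (simp add: cover_def)
qed

lemma cover_inv_cover:
  assumes v: "v permutes {1..m}"
  shows "cover (inv v) (cover v i) = i"
proof (cases "i = 0")
  case False
  define j where "j = cover v i"
  have ij: "1 \<le> i" "1 \<le> j" unfolding j_def using False cover_pos[OF v, of i] by auto
  have "(\<exists>k\<in>{1..j}. inv v k \<le> i) \<longleftrightarrow> (\<exists>k\<in>{1..i}. v k \<le> j)"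
  proof
    assume "\<exists>k\<in>{1..j}. inv v k \<le> i"
    then obtain k where "k \<in> {1..j}" "inv v k \<le> i" by blast
    then show "\<exists>k\<in>{1..i}. v k \<le> j"
      using permutes_pos[OF permutes_inv[OF v], of k]
      by (intro bexI[of _ "inv v k"]) (auto simp: permutes_inverses[OF v])
  next
    assume "\<exists>k\<in>{1..i}. v k \<le> j"
    then obtain k where "k \<in> {1..i}" "v k \<le> j" by blast
    then show "\<exists>k\<in>{1..j}. inv v k \<le> i"
      using permutes_pos[OF v, of k]
      by (intro bexI[of _ "v k"]) (auto simp: permutes_inverses[OF v])
  qed
  moreover have "inv v (Suc j) = Suc i \<longleftrightarrow> v (Suc i) = Suc j"
    by (rule permutes_inv_eq[OF v])
  moreover have "cover v i = j" by (simp add: j_def)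
  ultimately have "cover (inv v) j = i"
    unfolding cover_eq_iff[OF permutes_inv[OF v] ij(2,1)] cover_eq_iff[OF v ij]
      permutes_inv_inv[OF v]
    by (auto split: if_splits)
  then show ?thesis by (simp only: j_def)
qed (simp add: cover_def)

lemma cover_cover_inv:
  assumes "v permutes {1..m}"
  shows "cover v (cover (inv v) i) = i"
  using cover_inv_cover[OF permutes_inv[OF assms]] by (simp add: permutes_inv_inv[OF assms])

lemma inv_cover: "v permutes {1..m} \<Longrightarrow> inv (cover v) = cover (inv v)"
  by (intro inv_unique_comp) (auto simp: cover_inv_cover cover_cover_inv)

lemma cover_fixes:
  assumes v: "v permutes {1..Suc n}" and "i \<notin> {1..n}"
  shows "cover v i = i"
proof (cases "i = 0")
  case False
  then have i: "Suc n \<le> i" using assms by auto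
  have "v (Suc i) = Suc i" using v i by (intro permutes_not_in) auto
  moreover have "Min (v ` {1..i}) \<le> v 1" using False by (intro Min_le) auto
  moreover have "v 1 \<le> Suc n" using permutes_atMost_le[OF v] by simp
  ultimately have "max (Min (v ` {1..i})) (v (Suc i)) = Suc i" using i by linarith
  then show ?thesis using False by (simp add: cover_def)
qed (simp add: cover_def)

lemma cover_permutes:
  assumes "v permutes {1..Suc n}"
  shows "cover v permutes {1..n}"
  unfolding permutes_def
proof (intro conjI allI impI)
  show "cover v i = i" if "i \<notin> {1..n}" for i
    using assms that by (rule cover_fixes)
  show "\<exists>!i. cover v i = j" for j
    using cover_inv_cover[OF assms] cover_cover_inv[OF assms]
    by (intro ex1I[of _ "cover (inv v) j"]) auto
qed

lemma prefix_Min_Suc: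
  fixes v :: "nat \<Rightarrow> 'a::linorder"
  assumes "1 \<le> i"
  shows "Min (v ` {1..Suc i}) = min (Min (v ` {1..i})) (v (Suc i))"
  using assms by (simp add: atLeastAtMostSuc_conv min.commute)

lemma prefix_Min_comp_gen_s:
  assumes "1 \<le> i" "k \<noteq> i"
  shows "Min ((v \<circ> gen_s i) ` {1..k}) = Min (v ` {1..k})"
proof -
  have "gen_s i ` {1..k} = {1..k}"
  proof (cases "k < i")
    case True
    then show ?thesis by (auto simp: gen_s_apply image_iff)
  next
    case False
    then show ?thesis using assms by (intro permutes_image gen_s_permutes) auto
  qed
  then show ?thesis by (simp only: image_comp[symmetric])
qed

lemma cover_Suc:
  "1 \<le> i \<Longrightarrow> cover v (Suc i) = max (min (Min (v ` {1..i})) (v (Suc i))) (v (Suc (Suc i))) - 1"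
  by (simp only: cover_def prefix_Min_Suc) simp

lemma cover_comp_gen_s_1: "cover (v \<circ> gen_s 1) = cover v"
proof
  fix i :: nat
  consider "i = 0" | "i = 1" | "i \<noteq> 0 \<and> i \<noteq> 1" by blast
  then show "cover (v \<circ> gen_s 1) i = cover v i"
  proof cases
    case 3
    then show ?thesis
      using prefix_Min_comp_gen_s[of 1 i v] by (simp add: cover_def gen_s_apply)
  qed (simp_all add: cover_def gen_s_apply max.commute)
qed

lemma cover_comp_gen_s_Suc:
  assumes "1 \<le> i"
  shows "cover (v \<circ> gen_s (Suc i)) =
    (if v (Suc i) < Min (v ` {1..i}) \<and> v (Suc (Suc i)) < Min (v ` {1..i}) then cover v
     else cover v \<circ> gen_s i)"
proof
  fix k
  define u where "u = v \<circ> gen_s (Suc i)"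
  let ?h = "Min (v ` {1..i})"
  have same_Min: "Min (u ` {1..k}) = Min (v ` {1..k})" if "k \<noteq> Suc i" for k
    unfolding u_def using that by (intro prefix_Min_comp_gen_s) auto
  have u: "u (Suc i) = v (Suc (Suc i))" "u (Suc (Suc i)) = v (Suc i)"
    by (simp_all add: u_def gen_s_apply)
  have cover_u: "cover u i = max ?h (v (Suc (Suc i))) - 1"
      "cover u (Suc i) = max (min ?h (v (Suc (Suc i)))) (v (Suc i)) - 1"
    using assms unfolding cover_Suc[OF assms] u same_Min[of i, OF n_not_Suc_n]
    by (simp_all add: cover_def u same_Min del: One_nat_def)
  have cover_v: "cover v i = max ?h (v (Suc i)) - 1"
      "cover v (Suc i) = max (min ?h (v (Suc i))) (v (Suc (Suc i))) - 1"
    using assms unfolding cover_Suc[OF assms] by (simp_all add: cover_def)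
  consider "k = i" | "k = Suc i" | "k \<noteq> i" "k \<noteq> Suc i" by blast
  then have "cover u k =
      (if v (Suc i) < ?h \<and> v (Suc (Suc i)) < ?h then cover v k else cover v (gen_s i k))"
  proof cases
    case 3
    then have "u (Suc k) = v (Suc k)" "gen_s i k = k" by (simp_all add: u_def gen_s_apply)
    then show ?thesis using 3 by (simp add: cover_def same_Min del: One_nat_def)
  qed (auto simp: cover_u cover_v gen_s_apply)
  then show "cover (v \<circ> gen_s (Suc i)) k =
      (if v (Suc i) < ?h \<and> v (Suc (Suc i)) < ?h then cover v else cover v \<circ> gen_s i) k"
    by (simp add: u_def)
qed

lemma ell_S_cover_comp_gen_s_Suc_le_iff:
  assumes v: "v permutes {1..Suc n}" and i: "1 \<le> i" "i < n"
  shows "ell_S n (cover (v \<circ> gen_s (Suc i))) \<le> ell_S n (cover v) \<longleftrightarrow>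
    cover v (Suc i) < cover v i"
proof (cases "v (Suc i) < Min (v ` {1..i}) \<and> v (Suc (Suc i)) < Min (v ` {1..i})")
  case True
  then have "cover v i = Min (v ` {1..i}) - 1"
    "cover v (Suc i) = max (v (Suc i)) (v (Suc (Suc i))) - 1"
    using i(1) cover_Suc[OF i(1), of v] by (simp_all add: cover_def)
  moreover have "1 \<le> v (Suc i)" using permutes_pos[OF v] by simp
  ultimately have "cover v (Suc i) < cover v i" using True by linarith
  then show ?thesis using True by (simp add: cover_comp_gen_s_Suc[OF i(1)])
next
  case False
  then have "cover (v \<circ> gen_s (Suc i)) = cover v \<circ> gen_s i"
    unfolding cover_comp_gen_s_Suc[OF i(1)] by (rule if_not_P)
  then show ?thesis
    by (simp only: ell_S_comp_gen_s_le_iff[OF permutes_inj[OF cover_permutes[OF v]] i])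
qed

lemma card_less_le_1_iff:
  fixes V :: "'a::linorder set"
  assumes "finite V" "V \<noteq> {}"
  shows "card {y \<in> V. y < b} \<le> 1 \<longleftrightarrow> (\<forall>y\<in>V - {Min V}. b \<le> y)"
proof
  assume card: "card {y \<in> V. y < b} \<le> 1"
  show "\<forall>y\<in>V - {Min V}. b \<le> y"
  proof (rule ccontr)
    assume "\<not> (\<forall>y\<in>V - {Min V}. b \<le> y)"
    then obtain y where y: "y \<in> V" "y \<noteq> Min V" "y < b" by (auto simp: not_le)
    then have "Min V < b" using assms(1) by (meson Min_le le_less_trans)
    then have "{Min V, y} \<subseteq> {y \<in> V. y < b}" using assms y by auto
    then have "card {Min V, y} \<le> card {y \<in> V. y < b}" using assms(1) by (intro card_mono) auto
    then show False using card y(2) by simp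
  qed
next
  assume "\<forall>y\<in>V - {Min V}. b \<le> y"
  then have "{y \<in> V. y < b} \<subseteq> {Min V}" by (auto simp: not_less[symmetric])
  then show "card {y \<in> V. y < b} \<le> 1" using card_mono[of "{Min V}"] by simp
qed

lemma cover_lr_minimum_iff:
  assumes v: "v permutes {1..m}" and k: "1 \<le> k"
  shows "(\<forall>j\<in>{1..<k}. cover v k < cover v j) \<longleftrightarrow> card {j \<in> {1..<Suc k}. v j < v (Suc k)} \<le> 1"
proof -
  define V where "V = v ` {1..k}"
  have V: "finite V" "V \<noteq> {}" "v (Suc k) \<notin> V" 
    using k by (auto simp: V_def inj_eq[OF permutes_inj[OF v]])
  have image: "Suc ` cover v ` {1..<k} = V - {Min V}"
    using Suc_image_cover[OF v, of "k - 1"] k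
    by (cases k) (simp_all add: V_def atLeastLessThanSuc_atLeastAtMost)
  have max_less_iff: "max (Min V) (v (Suc k)) < y \<longleftrightarrow> v (Suc k) \<le> y" if "y \<in> V - {Min V}" for y
    using that V Min_le[of V y] by (auto simp: less_le)
  have Suc_cover: "Suc (cover v k) = max (Min V) (v (Suc k))"
    using k permutes_pos[OF v, of "Suc k"] by (simp add: cover_def V_def)
  have "(\<forall>j\<in>{1..<k}. cover v k < cover v j) \<longleftrightarrow>
      (\<forall>y\<in>Suc ` cover v ` {1..<k}. max (Min V) (v (Suc k)) < y)"
    by (simp flip: Suc_cover)
  also have "\<dots> \<longleftrightarrow> (\<forall>y\<in>V - {Min V}. v (Suc k) \<le> y)"
    unfolding image using max_less_iff by blast
  also have "\<dots> \<longleftrightarrow> card {y \<in> V. y < v (Suc k)} \<le> 1"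
    using V(1,2) by (rule card_less_le_1_iff[symmetric])
  also have "{y \<in> V. y < v (Suc k)} = v ` {j \<in> {1..<Suc k}. v j < v (Suc k)}"
    by (auto simp: V_def less_Suc_eq_le)
  also have "card \<dots> = card {j \<in> {1..<Suc k}. v j < v (Suc k)}"
    by (intro card_image permutes_inj_on[OF v])
  finally show ?thesis .
qed

lemma Del_A_eq_Suc_Del_S_cover:
  assumes "v permutes {1..Suc n}"
  shows "Del_A n v = Suc ` Del_S n (cover v)"
proof (rule set_eqI)
  show "i \<in> Del_A n v \<longleftrightarrow> i \<in> Suc ` Del_S n (cover v)" for i
  proof (cases i)
    case (Suc k)
    have "i \<in> Del_A n v \<longleftrightarrow> 1 < k \<and> k \<le> n \<and> card {j \<in> {1..<Suc k}. v j < v (Suc k)} \<le> 1"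
      unfolding Del_A_def Suc by auto
    also have "\<dots> \<longleftrightarrow> k \<in> Del_S n (cover v)"
      using cover_lr_minimum_iff[OF assms, of k] unfolding Del_S_def by auto
    finally show ?thesis by (simp add: Suc inj_image_mem_iff)
  qed (auto simp: Del_A_def)
qed

subsection \<open>Fibres of the covering map\<close>

definition sweep_fibre :: "'a::linorder \<Rightarrow> 'a list \<Rightarrow> 'a list set" where
  "sweep_fibre m c = {w. w \<noteq> [] \<and> sweep w = c \<and> Min (set w) = m}"

lemma mset_sweep_fibre: "w \<in> sweep_fibre m c \<Longrightarrow> mset w = add_mset m (mset c)"
  using add_mset_Min_mset_sweep[of w] by (auto simp: sweep_fibre_def)

lemma set_sweep_fibre: "w \<in> sweep_fibre m c \<Longrightarrow> set w = insert m (set c)"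
  by (metis mset_sweep_fibre set_mset_add_mset_insert set_mset_mset)

lemma sweep_fibre_Nil: "sweep_fibre m [] = {[m]}"
proof (intro equalityI subsetI)
  fix w assume "w \<in> sweep_fibre m []"
  then have "mset w = {#m#}" by (simp add: mset_sweep_fibre)
  then show "w \<in> {[m]}" by simp
qed (simp add: sweep_fibre_def sweep_def)

lemma less_if_in_sweep_fibre:
  assumes "w \<in> sweep_fibre a c" "a \<notin> set c" "y \<in> set c"
  shows "a < y"
proof -
  have "y \<in> set w" using assms(3) set_sweep_fibre[OF assms(1)] by simp
  then have "a \<le> y" using assms(1) by (auto simp: sweep_fibre_def)
  then show ?thesis using assms(2,3) by (metis le_neq_trans)
qed

lemma snoc_in_sweep_fibre_iff:
  assumes "m < a"
  shows "u @ [y] \<in> sweep_fibre m (c @ [a]) \<longleftrightarrow>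
    y = a \<and> u \<in> sweep_fibre m c \<or> y = m \<and> u \<in> sweep_fibre a c"
proof (cases "u = []")
  case False
  have "max x y = a \<and> min x y = m \<longleftrightarrow> x = m \<and> y = a \<or> x = a \<and> y = m" for x
    using assms by (auto simp: max_def min_def)
  from this[of "Min (set u)"] show ?thesis
    using False by (auto simp: sweep_fibre_def sweep_snoc min.commute)
qed (simp add: sweep_fibre_def)

lemma sweep_fibre_snoc:
  assumes "m < a" "a \<notin> set c"
  shows "sweep_fibre m (c @ [a]) = (\<lambda>w. w @ [a]) ` sweep_fibre m c \<union>
    (if \<forall>y\<in>set c. a < y then (\<lambda>w. w @ [m]) ` sweep_fibre a c else {})"
    (is "_ = ?R")
proof (rule set_eqI)
  fix w
  show "w \<in> sweep_fibre m (c @ [a]) \<longleftrightarrow> w \<in> ?R"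
  proof (cases w rule: rev_cases)
    case Nil
    then show ?thesis by (auto simp: sweep_fibre_def)
  next
    case (snoc u y)
    then show ?thesis
      using less_if_in_sweep_fibre[OF _ assms(2)]
      by (auto simp: snoc_in_sweep_fibre_iff[OF assms(1)])
  qed
qed

lemma card_sweep_fibre:
  assumes "distinct c" "\<forall>y\<in>set c. m < y"
  shows "card (sweep_fibre m c) = 2 ^ card (lr_minima c)"
  using assms
proof (induction c arbitrary: m rule: rev_induct)
  case Nil
  then show ?case by (simp add: sweep_fibre_Nil lr_minima_def)
next
  case (snoc a c)
  let ?snoc = "\<lambda>y w. w @ [y]"
  have "m < a" "a \<notin> set c" using snoc.prems by auto
  note fibre = sweep_fibre_snoc[OF this]
  have lr: "lr_minima (c @ [a]) = lr_minima c \<union> (if \<forall>y\<in>set c. a < y then {a} else {})"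
    using snoc.prems by (intro lr_minima_snoc) simp
  have IH: "card (?snoc z ` sweep_fibre y c) = 2 ^ card (lr_minima c)"
    if "\<forall>x\<in>set c. y < x" for y z
    using snoc that by (simp add: card_image inj_on_def)
  show ?case
  proof (cases "\<forall>y\<in>set c. a < y")
    case True
    have "finite (?snoc z ` sweep_fibre y c)" if "\<forall>x\<in>set c. y < x" for y z
      using IH[OF that] by (intro card_ge_0_finite) simp
    moreover have "?snoc a ` sweep_fibre m c \<inter> ?snoc m ` sweep_fibre a c = {}"
      using snoc.prems(2) by auto
    ultimately have "card (sweep_fibre m (c @ [a])) = 2 * 2 ^ card (lr_minima c)"
      unfolding fibre if_P[OF True] using snoc.prems True
      by (subst card_Un_disjoint) (auto simp: IH)
    also have "\<dots> = 2 ^ card (insert a (lr_minima c))"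
      using snoc.prems(1) lr_minima_subset[of c] finite_subset[OF lr_minima_subset, of c]
      by (subst card_insert_disjoint) auto
    finally show ?thesis using True by (simp add: lr)
  next
    case False
    then show ?thesis
      unfolding fibre lr if_not_P[OF False] using snoc.prems
      by (simp add: IH)
  qed
qed

lemma one_line_image_cover_fibre:
  assumes p: "p \<in> sym_perms n"
  shows "one_line (Suc n) ` {v \<in> sym_perms (Suc n). cover v = p} =
    sweep_fibre 1 (map Suc (one_line n p))"
proof (intro equalityI subsetI)
  fix w assume "w \<in> one_line (Suc n) ` {v \<in> sym_perms (Suc n). cover v = p}"
  then obtain v where v: "v permutes {1..Suc n}" "cover v = p" "w = one_line (Suc n) v"
    by (auto simp: sym_perms_def)
  have "Min (set w) = 1"
    unfolding v(3) set_one_line permutes_image[OF v(1)] by (intro Min_eqI) auto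
  then show "w \<in> sweep_fibre 1 (map Suc (one_line n p))"
    using sweep_one_line[OF v(1)] v(2,3) by (simp add: sweep_fibre_def one_line_Suc)
next
  fix w assume w: "w \<in> sweep_fibre 1 (map Suc (one_line n p))"
  have c: "set (one_line n p) = {1..n}" "distinct (one_line n p)"
    using one_line_in_permutations_of_set[OF p] by (simp_all add: permutations_of_set_def)
  have "set w = {1..Suc n}" by (auto simp: set_sweep_fibre[OF w] c(1) image_Suc_atLeastAtMost)
  moreover have "distinct w"
    using mset_eq_imp_distinct_iff[of w "1 # map Suc (one_line n p)"] mset_sweep_fibre[OF w] c
    by (auto simp: distinct_map)
  ultimately have "w \<in> permutations_of_set {1..Suc n}" by (rule permutations_of_setI)
  then obtain v where v: "v \<in> sym_perms (Suc n)" "w = one_line (Suc n) v"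
    using bij_betw_imp_surj_on[OF bij_betw_one_line] by blast
  then have vp: "v permutes {1..Suc n}" by (simp add: sym_perms_def)
  have "one_line n (cover v) = one_line n p"
    using w sweep_one_line[OF vp] v(2) by (simp add: sweep_fibre_def)
  moreover have "cover v \<in> sym_perms n" using cover_permutes[OF vp] by (simp add: sym_perms_def)
  ultimately have "cover v = p" using inj_onD[OF inj_on_one_line] p by blast
  then show "w \<in> one_line (Suc n) ` {v \<in> sym_perms (Suc n). cover v = p}" using v by auto
qed

lemma card_cover_fibre_sym_perms:
  assumes n: "1 \<le> n" and p: "p \<in> sym_perms n"
  shows "card {v \<in> sym_perms (Suc n). cover v = p} = 2 ^ Suc (card (Del_S n (inv p)))"
proof -
  have pp: "p permutes {1..n}" using p by (simp add: sym_perms_def)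
  have c: "set (one_line n p) = {1..n}" "distinct (one_line n p)"
    using one_line_in_permutations_of_set[OF p] by (simp_all add: permutations_of_set_def)
  have "card {v \<in> sym_perms (Suc n). cover v = p} =
      card (one_line (Suc n) ` {v \<in> sym_perms (Suc n). cover v = p})"
    by (intro card_image[symmetric] inj_on_subset[OF inj_on_one_line]) auto
  also have "\<dots> = 2 ^ card (lr_minima (map Suc (one_line n p)))"
    unfolding one_line_image_cover_fibre[OF p] using c
    by (intro card_sweep_fibre) (auto simp: distinct_map)
  also have "card (lr_minima (map Suc (one_line n p))) = card (lr_minima (one_line n p))"
    by (simp add: lr_minima_map strict_mono_def card_image)
  also have "lr_minima (one_line n p) = insert 1 (Del_S n (inv p))"
    using n by (auto simp: Del_S_inv_eq_lr_minima[OF pp] lr_minima_def c(1))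
  also have "card \<dots> = Suc (card (Del_S n (inv p)))"
    by (subst card_insert_disjoint) (auto simp: Del_S_def)
  finally show ?thesis .
qed

subsection \<open>Canonical presentations in the alternating group\<close>

lemma id_in_alt_perms: "id \<in> alt_perms m"
  by (simp add: alt_perms_def)

lemma comp_in_alt_perms: "\<lbrakk>p \<in> alt_perms m; q \<in> alt_perms m\<rbrakk> \<Longrightarrow> p \<circ> q \<in> alt_perms m"
  by (auto simp: alt_perms_def evenperm_comp permutes_imp_permutation[OF finite_atLeastAtMost]
      intro: permutes_compose)

lemma inv_in_alt_perms: "p \<in> alt_perms m \<Longrightarrow> inv p \<in> alt_perms m"
  by (auto simp: alt_perms_def evenperm_inv permutes_imp_permutation[OF finite_atLeastAtMost]
      intro: permutes_inv)

lemma alt_perms_subset_sym_perms: "alt_perms m \<subseteq> sym_perms m"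
  by (auto simp: alt_perms_def sym_perms_def)

lemma finite_alt_perms: "finite (alt_perms m)"
  using alt_perms_subset_sym_perms finite_sym_perms by (rule finite_subset)

lemma in_alt_perms_iff_fixes:
  assumes "u \<in> alt_perms (Suc m)"
  shows "u \<in> alt_perms m \<longleftrightarrow> u (Suc m) = Suc m"
proof
  assume "u \<in> alt_perms m"
  then show "u (Suc m) = Suc m" by (auto simp: alt_perms_def intro: permutes_not_in)
next
  assume "u (Suc m) = Suc m"
  moreover have "{1..Suc m} - {1..m} = {Suc m}" by auto
  moreover have "u permutes {1..Suc m}" "evenperm u" using assms by (simp_all add: alt_perms_def)
  ultimately show "u \<in> alt_perms m"
    unfolding alt_perms_def by (metis (mono_tags) mem_Collect_eq permutes_superset singletonD)
qed

lemma alt_perms_2: "alt_perms 2 = {id}"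
proof (intro equalityI subsetI)
  fix v assume "v \<in> alt_perms 2"
  moreover have "{1..2::nat} = {1, 2}" by auto
  ultimately have "v permutes {1, 2}" "evenperm v" by (simp_all add: alt_perms_def)
  then show "v \<in> {id}" by (auto simp: permutes_doubleton_iff evenperm_swap)
qed (simp add: id_in_alt_perms)

lemma gen_a_in_alt_perms:
  assumes "1 \<le> i" "Suc (Suc i) \<le> m"
  shows "gen_a i \<in> alt_perms m"
proof -
  have "gen_a i permutes {1..m}"
    unfolding gen_a_def using assms by (intro permutes_compose gen_s_permutes) auto
  moreover have "evenperm (gen_a i)"
    by (simp add: gen_a_def evenperm_comp permutation_gen_s not_evenperm_gen_s)
  ultimately show ?thesis by (simp add: alt_perms_def)
qed

lemma comp_gen_a: "v \<circ> gen_a i = v \<circ> gen_s 1 \<circ> gen_s (Suc i)"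
  by (simp add: gen_a_def comp_assoc)

lemma inv_gen_a_1: "inv (gen_a 1) = gen_s 2 \<circ> gen_s 1"
proof -
  have "bij (gen_s i)" for i using permutation_gen_s by (rule permutation_bijective)
  moreover have "inv (gen_s i) = gen_s i" for i by (simp add: gen_s_def)
  ultimately show ?thesis by (simp add: gen_a_def o_inv_distrib numeral_2_eq_2)
qed

lemma word_perm_Nil [simp]: "word_perm [] = id"
  by (simp add: word_perm_def)

lemma word_perm_Cons: "word_perm (x # w) = letter_perm x \<circ> word_perm w"
  by (simp add: word_perm_def)

lemma word_perm_append: "word_perm (xs @ ys) = word_perm xs \<circ> word_perm ys"
  by (induction xs) (auto simp: word_perm_Cons)

lemma word_perm_in_alt_perms:
  assumes "\<And>x. x \<in> set w \<Longrightarrow> 1 \<le> fst x \<and> Suc (Suc (fst x)) \<le> m"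
  shows "word_perm w \<in> alt_perms m"
  using assms
proof (induction w)
  case Nil
  show ?case by (simp add: id_in_alt_perms del: id_apply)
next
  case (Cons x w)
  have "letter_perm x \<in> alt_perms m"
    using Cons.prems[of x] gen_a_in_alt_perms[of "fst x" m] inv_in_alt_perms
    by (auto simp: letter_perm_def)
  then show ?case
    unfolding word_perm_Cons using Cons by (intro comp_in_alt_perms) auto
qed

lemma desc_word_empty [simp]: "desc_word j (Suc j) = []"
  by (simp add: desc_word_def)

lemma desc_word_snoc: "k \<le> j \<Longrightarrow> desc_word j k = desc_word j (Suc k) @ [(k, True)]"
  by (simp add: desc_word_def upt_conv_Cons del: upt_Suc)

text \<open>The word of \<open>R_A j\<close> whose permutation sends \<open>i\<close> to \<open>j + 2\<close>.\<close>

definition coset_word :: "nat \<Rightarrow> nat \<Rightarrow> A_word" where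
  "coset_word j i = (if i = 1 then desc_word j 2 @ [(1, False)] else desc_word j (i - 1))"

lemma R_A_eq_coset_words: "R_A j = coset_word j ` {1..Suc (Suc j)}"
proof -
  have "{1..Suc (Suc j)} = insert 1 (Suc ` {1..Suc j})"
    by (auto simp: image_Suc_atLeastAtMost)
  moreover have "coset_word j ` Suc ` {1..Suc j} = desc_word j ` {1..Suc j}"
    unfolding image_image by (intro image_cong) (auto simp: coset_word_def)
  ultimately have "coset_word j ` {1..Suc (Suc j)} =
      insert (coset_word j 1) (desc_word j ` {1..Suc j})"
    by (simp only: image_insert)
  then show ?thesis by (auto simp: R_A_def coset_word_def)
qed

lemma word_perm_R_A_in_alt_perms:
  "\<lbrakk>1 \<le> j; r \<in> R_A j\<rbrakk> \<Longrightarrow> word_perm r \<in> alt_perms (Suc (Suc j))"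
  by (intro word_perm_in_alt_perms) (auto simp: R_A_def desc_word_def)

lemma word_perm_desc_word_apply:
  assumes "k \<le> Suc j" "1 \<le> k"
  shows "word_perm (desc_word j k) (Suc k) = Suc (Suc j)"
  using assms
proof (induction k rule: inc_induct)
  case base
  then show ?case by simp
next
  case (step k)
  have "gen_a k (Suc k) = Suc (Suc k)" using step.prems by (simp add: gen_a_def gen_s_apply)
  then show ?case
    using step by (simp add: desc_word_snoc word_perm_append word_perm_Cons letter_perm_def)
qed

lemma word_perm_coset_word_apply:
  assumes j: "1 \<le> j" and i: "i \<in> {1..Suc (Suc j)}"
  shows "word_perm (coset_word j i) i = Suc (Suc j)"
proof (cases "i = 1")
  case True
  have "inv (gen_a 1) 1 = Suc 2" unfolding inv_gen_a_1 by (simp add: gen_s_apply)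
  then show ?thesis
    using True word_perm_desc_word_apply[of 2 j] j
    by (simp add: coset_word_def word_perm_append word_perm_Cons letter_perm_def)
next
  case False
  then obtain k where "i = Suc k" "1 \<le> k" "k \<le> Suc j" using i by (cases i) auto
  then show ?thesis using word_perm_desc_word_apply[of k j] by (simp add: coset_word_def)
qed

lemma R_A_eq_coset_word_iff:
  assumes j: "1 \<le> j" and r: "r \<in> R_A j" and i: "i \<in> {1..Suc (Suc j)}"
  shows "r = coset_word j i \<longleftrightarrow> word_perm r i = Suc (Suc j)"
proof
  assume "word_perm r i = Suc (Suc j)"
  moreover obtain k where k: "k \<in> {1..Suc (Suc j)}" "r = coset_word j k"
    using r by (auto simp: R_A_eq_coset_words)
  moreover have "inj (word_perm r)"
    using word_perm_R_A_in_alt_perms[OF j r] permutes_inj by (auto simp: alt_perms_def)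
  ultimately have "i = k" using word_perm_coset_word_apply[OF j k(1)] by (metis injD)
  then show "r = coset_word j i" using k(2) by simp
qed (simp add: word_perm_coset_word_apply[OF j i])

lemma comp_inv_R_A_in_alt_perms_iff:
  assumes n: "1 \<le> n" and r: "r \<in> R_A n" and v: "v \<in> alt_perms (Suc (Suc n))"
  shows "v \<circ> inv (word_perm r) \<in> alt_perms (Suc n) \<longleftrightarrow>
    r = coset_word n (inv v (Suc (Suc n)))"
proof -
  let ?N = "Suc (Suc n)"
  have w: "word_perm r \<in> alt_perms ?N" using n r by (rule word_perm_R_A_in_alt_perms)
  have p: "v permutes {1..?N}" "word_perm r permutes {1..?N}"
    using v w by (simp_all add: alt_perms_def)
  have "v \<circ> inv (word_perm r) \<in> alt_perms (Suc n) \<longleftrightarrow> v (inv (word_perm r) ?N) = ?N"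
    using in_alt_perms_iff_fixes[OF comp_in_alt_perms[OF v inv_in_alt_perms[OF w]]] by simp
  also have "\<dots> \<longleftrightarrow> word_perm r (inv v ?N) = ?N"
    by (metis permutes_inverses[OF p(1)] permutes_inverses[OF p(2)])
  also have "\<dots> \<longleftrightarrow> r = coset_word n (inv v ?N)"
    by (intro R_A_eq_coset_word_iff[symmetric] n r)
      (use permutes_in_image[OF permutes_inv[OF p(1)], of ?N] in simp)
  finally show ?thesis .
qed

lemma A_presentation_in_alt_perms:
  assumes "A_presentation n v ws"
  shows "v \<in> alt_perms (Suc n)"
proof -
  have "1 \<le> fst x \<and> Suc (Suc (fst x)) \<le> Suc n" if x: "x \<in> set (concat ws)" for x
  proof -
    obtain w where "w \<in> set ws" "x \<in> set w" using x by auto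
    then obtain j where j: "j < n - 1" "x \<in> set (ws ! j)" "ws ! j \<in> R_A (Suc j)"
      using assms by (auto simp: A_presentation_def in_set_conv_nth[of w])
    have "Suc (Suc j) \<le> n" using j(1) by simp
    then show ?thesis using j(2,3) by (auto simp: R_A_def desc_word_def)
  qed
  then show ?thesis
    using word_perm_in_alt_perms[of "concat ws" "Suc n"] assms by (simp add: A_presentation_def)
qed

lemma A_presentation_snoc_iff:
  assumes n: "1 \<le> n"
  shows "A_presentation (Suc n) v (us @ [r]) \<longleftrightarrow>
    r \<in> R_A n \<and> A_presentation n (v \<circ> inv (word_perm r)) us"
proof -
  obtain m where m: "n = Suc m" using n by (cases n) auto
  have factors: "(\<forall>j<n. (us @ [r]) ! j \<in> R_A (Suc j)) \<longleftrightarrow>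
      r \<in> R_A n \<and> (\<forall>j<n - 1. us ! j \<in> R_A (Suc j))" if "length us = n - 1"
    using that by (auto simp: m All_less_Suc nth_append)
  have product: "word_perm (concat us) \<circ> word_perm r = v \<longleftrightarrow>
      word_perm (concat us) = v \<circ> inv (word_perm r)" if r: "r \<in> R_A n"
  proof -
    have "bij (word_perm r)"
      using word_perm_R_A_in_alt_perms[OF n r] permutes_bij by (auto simp: alt_perms_def)
    then show ?thesis
      by (metis bij_is_inj bij_is_surj comp_assoc comp_id inv_o_cancel surj_iff)
  qed
  have "A_presentation (Suc n) v (us @ [r]) \<longleftrightarrow> length us = n - 1 \<and>
      (\<forall>j<n. (us @ [r]) ! j \<in> R_A (Suc j)) \<and> word_perm (concat us) \<circ> word_perm r = v"
    using n by (auto simp: A_presentation_def word_perm_append)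
  also have "\<dots> \<longleftrightarrow> r \<in> R_A n \<and> A_presentation n (v \<circ> inv (word_perm r)) us"
    unfolding A_presentation_def Suc_eq_plus1[symmetric] using factors product by blast
  finally show ?thesis .
qed

lemma ex1_A_presentation:
  assumes "1 \<le> n" "v \<in> alt_perms (Suc n)"
  shows "\<exists>!ws. A_presentation n v ws"
  using assms
proof (induction n arbitrary: v rule: dec_induct)
  case base
  then have "v = id" using alt_perms_2 by (simp add: numeral_2_eq_2)
  then show ?case by (intro ex1I[of _ "[]"]) (auto simp: A_presentation_def)
next
  case (step n)
  let ?i = "inv v (Suc (Suc n))"
  define r where "r = coset_word n ?i"
  have "v permutes {1..Suc (Suc n)}" using step.prems by (simp add: alt_perms_def)
  then have "?i \<in> {1..Suc (Suc n)}"
    by (subst permutes_in_image[OF permutes_inv]) auto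
  then have r: "r \<in> R_A n" by (simp add: r_def R_A_eq_coset_words)
  have snoc: "A_presentation (Suc n) v ws \<longleftrightarrow>
      (\<exists>us. ws = us @ [r] \<and> A_presentation n (v \<circ> inv (word_perm r)) us)" for ws
  proof (cases ws rule: rev_cases)
    case Nil
    then show ?thesis using step.hyps by (simp add: A_presentation_def)
  next
    case (snoc us s)
    have "s = r" if "s \<in> R_A n" "A_presentation n (v \<circ> inv (word_perm s)) us"
      using that comp_inv_R_A_in_alt_perms_iff[OF step.hyps(1) that(1) step.prems]
        A_presentation_in_alt_perms by (auto simp: r_def)
    then show ?thesis using r step.hyps by (auto simp: snoc A_presentation_snoc_iff)
  qed
  have "v \<circ> inv (word_perm r) \<in> alt_perms (Suc n)"
    using comp_inv_R_A_in_alt_perms_iff[OF step.hyps(1) r step.prems] by (simp add: r_def)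
  then have "\<exists>!us. A_presentation n (v \<circ> inv (word_perm r)) us" by (rule step.IH)
  then show ?case unfolding snoc by blast
qed

lemma ell_S_cover_comp_gen_s_move_max:
  assumes v: "v permutes {1..Suc (Suc n)}" and k: "1 \<le> k" "k \<le> n"
    and max: "v (Suc (Suc k)) = Suc (Suc n)"
  shows "ell_S (Suc n) (cover (v \<circ> gen_s (Suc k))) = Suc (ell_S (Suc n) (cover v))"
proof -
  have cover_v: "cover v permutes {1..Suc n}" using v by (rule cover_permutes)
  have "Min (v ` {1..k}) \<le> v 1" using k by (intro Min_le) auto
  also have "v 1 \<le> v (Suc (Suc k))" using permutes_atMost_le[OF v, of 1] max by simp
  finally have eq: "cover (v \<circ> gen_s (Suc k)) = cover v \<circ> gen_s k"
    by (simp add: cover_comp_gen_s_Suc[OF k(1)] not_less)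
  have "Suc n \<le> cover v (Suc k)" using max by (simp add: cover_def)
  moreover have "cover v k \<le> Suc n" using permutes_atMost_le[OF cover_v, of k] k by simp
  moreover have "cover v k \<noteq> cover v (Suc k)" by (simp add: inj_eq[OF permutes_inj[OF cover_v]])
  ultimately show ?thesis unfolding eq using k by (intro ell_S_comp_gen_s) auto
qed

lemma ell_S_cover_comp_desc_word_snoc:
  assumes u: "u permutes {1..Suc n}" and k: "1 \<le> k" "k \<le> n" and b: "b \<or> k = 1"
  shows "ell_S (Suc n) (cover (u \<circ> word_perm (desc_word n (Suc k) @ [(k, b)]))) =
    Suc (ell_S (Suc n) (cover (u \<circ> word_perm (desc_word n (Suc k)))))"
proof -
  define v where "v = u \<circ> word_perm (desc_word n (Suc k))"
  have "desc_word n (Suc k) \<in> R_A n" using k by (auto simp: R_A_def)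
  then have "word_perm (desc_word n (Suc k)) \<in> alt_perms (Suc (Suc n))"
    using k by (intro word_perm_R_A_in_alt_perms) auto
  then have v: "v permutes {1..Suc (Suc n)}"
    unfolding v_def alt_perms_def using permutes_subset[OF u]
    by (auto intro!: permutes_compose)
  have max: "v (Suc (Suc k)) = Suc (Suc n)"
    using word_perm_desc_word_apply[of "Suc k" n] k permutes_not_in[OF u, of "Suc (Suc n)"]
    by (simp add: v_def)
  have "ell_S (Suc n) (cover (v \<circ> letter_perm (k, b))) = Suc (ell_S (Suc n) (cover v))"
  proof (cases b)
    case True
    have "v \<circ> gen_s 1 permutes {1..Suc (Suc n)}"
      using v k by (intro permutes_comp_gen_s) auto
    moreover have "(v \<circ> gen_s 1) (Suc (Suc k)) = Suc (Suc n)"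
      using max k by (simp add: gen_s_apply)
    ultimately have "ell_S (Suc n) (cover (v \<circ> gen_s 1 \<circ> gen_s (Suc k))) =
        Suc (ell_S (Suc n) (cover (v \<circ> gen_s 1)))"
      using k by (intro ell_S_cover_comp_gen_s_move_max)
    moreover have "letter_perm (k, b) = gen_a k" using True by (simp add: letter_perm_def)
    ultimately show ?thesis by (simp only: comp_gen_a cover_comp_gen_s_1)
  next
    case False
    then have "v \<circ> letter_perm (k, b) = v \<circ> gen_s (Suc k) \<circ> gen_s 1"
      using b inv_gen_a_1 by (simp add: letter_perm_def comp_assoc numeral_2_eq_2)
    then show ?thesis
      using ell_S_cover_comp_gen_s_move_max[OF v k max] by (simp only: cover_comp_gen_s_1)
  qed
  then show ?thesis by (simp add: word_perm_append word_perm_Cons v_def comp_assoc)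
qed

lemma ell_S_cover_comp_desc_word:
  assumes u: "u permutes {1..Suc n}" and "k \<le> Suc n" "1 \<le> k"
  shows "ell_S (Suc n) (cover (u \<circ> word_perm (desc_word n k))) =
    ell_S n (cover u) + length (desc_word n k)"
  using assms(2,3)
proof (induction k rule: inc_induct)
  case base
  show ?case using ell_S_Suc[OF cover_permutes[OF u]] by simp
next
  case (step k)
  then show ?case
    using ell_S_cover_comp_desc_word_snoc[OF u, of k True] by (simp add: desc_word_snoc comp_def)
qed

lemma ell_S_cover_comp_R_A:
  assumes u: "u permutes {1..Suc n}" and n: "1 \<le> n" and r: "r \<in> R_A n"
  shows "ell_S (Suc n) (cover (u \<circ> word_perm r)) = ell_S n (cover u) + length r"
proof -
  obtain i where i: "i \<in> {1..Suc (Suc n)}" "r = coset_word n i"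
    using r by (auto simp: R_A_eq_coset_words)
  show ?thesis
  proof (cases "i = 1")
    case True
    then have r: "r = desc_word n (Suc 1) @ [(1, False)]"
      by (simp add: i coset_word_def numeral_2_eq_2)
    show ?thesis
      unfolding r ell_S_cover_comp_desc_word_snoc[OF u order_refl n disjI2[OF refl]]
      using ell_S_cover_comp_desc_word[OF u, of "Suc 1"] n by simp
  next
    case False
    then obtain k where "i = Suc k" "1 \<le> k" "k \<le> Suc n" using i(1) by (cases i) auto
    then show ?thesis
      using ell_S_cover_comp_desc_word[OF u, of k] i(2) by (simp add: coset_word_def)
  qed
qed

lemma length_A_presentation:
  assumes "1 \<le> n" "A_presentation n v ws"
  shows "length (concat ws) = ell_S n (cover v)"
  using assms
proof (induction n arbitrary: v ws rule: dec_induct)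
  case base
  have empty: "{(i, j). 1 \<le> i \<and> i < j \<and> j \<le> (1::nat) \<and> cover v i > cover v j} = {}" by auto
  show ?case using base unfolding ell_S_def empty by (simp add: A_presentation_def)
next
  case (step n)
  have "ws \<noteq> []" using step by (auto simp: A_presentation_def)
  then obtain us r where ws: "ws = us @ [r]" by (metis rev_exhaust)
  define u where "u = v \<circ> inv (word_perm r)"
  have r: "r \<in> R_A n" and us: "A_presentation n u us"
    using step ws A_presentation_snoc_iff by (simp_all add: u_def)
  have u: "u permutes {1..Suc n}"
    using A_presentation_in_alt_perms[OF us] by (simp add: alt_perms_def)
  have "word_perm r permutes {1..Suc (Suc n)}"
    using word_perm_R_A_in_alt_perms[OF step.hyps(1) r] by (simp add: alt_perms_def)
  then have "v = u \<circ> word_perm r" by (simp add: u_def comp_assoc permutes_inv_o(2))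
  then show ?case
    using ell_S_cover_comp_R_A[OF u step.hyps(1) r] step.IH[OF us] by (simp add: ws comp_def)
qed

lemma ell_A_eq_ell_S_cover:
  assumes "1 \<le> n" "v \<in> alt_perms (Suc n)"
  shows "ell_A n v = ell_S n (cover v)"
  using length_A_presentation[OF assms(1) theI'[OF ex1_A_presentation[OF assms]]]
  by (simp add: ell_A_def)

lemma Des_A_eq_Des_S_cover:
  assumes n: "1 \<le> n" and v: "v \<in> alt_perms (Suc n)"
  shows "Des_A n v = Des_S n (cover v)"
proof -
  have "ell_A n (v \<circ> gen_a i) \<le> ell_A n v \<longleftrightarrow> cover v (Suc i) < cover v i"
    if i: "i \<in> {1..n - 1}" for i
  proof -
    have "v \<circ> gen_a i \<in> alt_perms (Suc n)"
      using v i by (intro comp_in_alt_perms gen_a_in_alt_perms) auto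
    moreover have "v \<circ> gen_s 1 permutes {1..Suc n}"
      using v i unfolding alt_perms_def by (intro permutes_comp_gen_s) auto
    then have "ell_S n (cover (v \<circ> gen_s 1 \<circ> gen_s (Suc i))) \<le> ell_S n (cover (v \<circ> gen_s 1)) \<longleftrightarrow>
        cover (v \<circ> gen_s 1) (Suc i) < cover (v \<circ> gen_s 1) i"
      by (rule ell_S_cover_comp_gen_s_Suc_le_iff) (use i in auto)
    ultimately show ?thesis
      using v by (simp only: ell_A_eq_ell_S_cover[OF n] comp_gen_a cover_comp_gen_s_1)
  qed
  then show ?thesis by (auto simp: Des_A_def Des_S_def)
qed

lemma rmaj_A_eq_rmaj_S_cover:
  "\<lbrakk>1 \<le> n; v \<in> alt_perms (Suc n)\<rbrakk> \<Longrightarrow> rmaj_A n v = rmaj_S n (cover v)"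
  by (simp add: rmaj_A_def rmaj_S_def Des_A_eq_Des_S_cover)

subsection \<open>Equidistribution on the alternating group\<close>

lemma comp_gen_s_1_in_alt_perms_iff:
  assumes "2 \<le> m" "v \<in> sym_perms m"
  shows "v \<circ> gen_s 1 \<in> alt_perms m \<longleftrightarrow> v \<notin> alt_perms m"
proof -
  have "v permutes {1..m}" using assms by (simp add: sym_perms_def)
  moreover from this have "v \<circ> gen_s 1 permutes {1..m}"
    using assms by (intro permutes_comp_gen_s) auto
  ultimately show ?thesis
    by (auto simp: alt_perms_def evenperm_comp permutes_imp_permutation[OF finite_atLeastAtMost]
        permutation_gen_s not_evenperm_gen_s)
qed

text \<open>Swapping the first two entries of \<open>v\<close> changes its parity but not \<open>cover v\<close>.\<close>

lemma card_cover_fibre_alt_perms: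
  assumes n: "1 \<le> n" and p: "p \<in> sym_perms n"
  shows "card {v \<in> alt_perms (Suc n). cover v = p} = 2 ^ card (Del_S n (inv p))"
proof -
  let ?A = "alt_perms (Suc n)" and ?S = "sym_perms (Suc n)"
  have invol: "v \<circ> gen_s 1 \<circ> gen_s 1 = v" for v :: "nat \<Rightarrow> nat" by (simp add: comp_assoc)
  have "bij_betw (\<lambda>v. v \<circ> gen_s 1) {v \<in> ?A. cover v = p} {v \<in> ?S - ?A. cover v = p}"
  proof (rule bij_betw_byWitness[where f' = "\<lambda>v. v \<circ> gen_s 1"])
    have S: "v \<circ> gen_s 1 \<in> ?S" if "v \<in> ?S" for v
      using that n permutes_comp_gen_s[of v "Suc n" 1] by (simp add: sym_perms_def)
    show "(\<lambda>v. v \<circ> gen_s 1) ` {v \<in> ?A. cover v = p} \<subseteq> {v \<in> ?S - ?A. cover v = p}"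
      using n S alt_perms_subset_sym_perms[of "Suc n"]
      by (auto simp: cover_comp_gen_s_1 comp_gen_s_1_in_alt_perms_iff simp del: One_nat_def)
    show "(\<lambda>v. v \<circ> gen_s 1) ` {v \<in> ?S - ?A. cover v = p} \<subseteq> {v \<in> ?A. cover v = p}"
      using n by (auto simp: cover_comp_gen_s_1 comp_gen_s_1_in_alt_perms_iff simp del: One_nat_def)
  qed (simp_all add: invol del: One_nat_def)
  then have "card {v \<in> ?S - ?A. cover v = p} = card {v \<in> ?A. cover v = p}"
    by (rule bij_betw_same_card[symmetric])
  moreover have "{v \<in> ?S. cover v = p} = {v \<in> ?A. cover v = p} \<union> {v \<in> ?S - ?A. cover v = p}"
    using alt_perms_subset_sym_perms by auto
  then have "card {v \<in> ?S. cover v = p} =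
      card {v \<in> ?A. cover v = p} + card {v \<in> ?S - ?A. cover v = p}"
    by (simp only:) (rule card_Un_disjoint; auto simp: finite_alt_perms finite_sym_perms)
  ultimately show ?thesis using card_cover_fibre_sym_perms[OF n p] by simp
qed

lemma sum_alt_perms_cover:
  fixes G :: "(nat \<Rightarrow> nat) \<Rightarrow> 'a::semiring_1"
  assumes "1 \<le> n"
  shows "(\<Sum>v\<in>alt_perms (Suc n). G (cover v)) =
    (\<Sum>p\<in>sym_perms n. 2 ^ card (Del_S n (inv p)) * G p)"
proof -
  have "cover ` alt_perms (Suc n) \<subseteq> sym_perms n"
    using cover_permutes by (auto simp: alt_perms_def sym_perms_def)
  then have "(\<Sum>v\<in>alt_perms (Suc n). G (cover v)) =
      (\<Sum>p\<in>sym_perms n. \<Sum>v\<in>{v \<in> alt_perms (Suc n). cover v = p}. G (cover v))"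
    by (intro sum.group[symmetric] finite_alt_perms finite_sym_perms)
  also have "\<dots> = (\<Sum>p\<in>sym_perms n. 2 ^ card (Del_S n (inv p)) * G p)"
    by (intro sum.cong refl) (simp add: card_cover_fibre_alt_perms[OF assms])
  finally show ?thesis .
qed

lemma sum_rmaj_A_eq_sum_ell_A:
  fixes F :: "nat set \<Rightarrow> nat set \<Rightarrow> nat \<Rightarrow> 'a::semiring_1"
  assumes n: "1 \<le> n"
  shows "(\<Sum>v\<in>alt_perms (Suc n). F (Des_A n (inv v)) (Del_A n (inv v)) (rmaj_A n v)) =
    (\<Sum>v\<in>alt_perms (Suc n). F (Des_A n (inv v)) (Del_A n (inv v)) (ell_A n v))"
proof -
  let ?A = "alt_perms (Suc n)"
  let ?G = "\<lambda>t p. F (Des_S n (inv p)) (Suc ` Del_S n (inv p)) (t p)"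
  have inv: "Des_A n (inv v) = Des_S n (inv (cover v))"
    "Del_A n (inv v) = Suc ` Del_S n (inv (cover v))" if "v \<in> ?A" for v
  proof -
    have v: "v permutes {1..Suc n}" using that by (simp add: alt_perms_def)
    show "Des_A n (inv v) = Des_S n (inv (cover v))"
      unfolding inv_cover[OF v] using n inv_in_alt_perms[OF that] by (rule Des_A_eq_Des_S_cover)
    show "Del_A n (inv v) = Suc ` Del_S n (inv (cover v))"
      unfolding inv_cover[OF v] using permutes_inv[OF v] by (rule Del_A_eq_Suc_Del_S_cover)
  qed
  have "(\<Sum>v\<in>?A. F (Des_A n (inv v)) (Del_A n (inv v)) (rmaj_A n v)) =
      (\<Sum>v\<in>?A. ?G (rmaj_S n) (cover v))"
    by (simp add: inv rmaj_A_eq_rmaj_S_cover[OF n])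
  also have "\<dots> = (\<Sum>p\<in>sym_perms n. 2 ^ card (Del_S n (inv p)) * ?G (rmaj_S n) p)"
    by (rule sum_alt_perms_cover[OF n])
  also have "\<dots> = (\<Sum>p\<in>sym_perms n. 2 ^ card (Del_S n (inv p)) * ?G (ell_S n) p)"
    by (rule sum_rmaj_S_eq_sum_ell_S[of "\<lambda>D L k. 2 ^ card L * F D (Suc ` L) k"])
  also have "\<dots> = (\<Sum>v\<in>?A. ?G (ell_S n) (cover v))"
    by (rule sum_alt_perms_cover[OF n, symmetric])
  also have "\<dots> = (\<Sum>v\<in>?A. F (Des_A n (inv v)) (Del_A n (inv v)) (ell_A n v))"
    by (simp add: inv ell_A_eq_ell_S_cover[OF n])
  finally show ?thesis .
qed

theorem theorem9p1:
  fixes n :: nat and D1 D2 :: "nat set"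
  assumes "n \<ge> 1" and "D1 \<subseteq> {1..n - 1}" and "D2 \<subseteq> {1..n - 1}"
  shows "(\<Sum>p \<in> {p \<in> sym_perms n. Des_S n (inv p) \<subseteq> D1 \<and> Del_S n (inv p) \<subseteq> D2}.
            monom (1::int) (rmaj_S n p)) =
         (\<Sum>p \<in> {p \<in> sym_perms n. Des_S n (inv p) \<subseteq> D1 \<and> Del_S n (inv p) \<subseteq> D2}.
            monom (1::int) (ell_S n p)) \<and>
         (\<Sum>p \<in> {p \<in> alt_perms (n + 1). Des_A n (inv p) \<subseteq> D1 \<and> Del_A n (inv p) \<subseteq> D2}.
            monom (1::int) (rmaj_A n p)) =
         (\<Sum>p \<in> {p \<in> alt_perms (n + 1). Des_A n (inv p) \<subseteq> D1 \<and> Del_A n (inv p) \<subseteq> D2}.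
            monom (1::int) (ell_A n p))"
proof -
  let ?F = "\<lambda>D L k. if D \<subseteq> D1 \<and> L \<subseteq> D2 then monom (1::int) k else 0"
  show ?thesis
    unfolding sum.inter_filter[OF finite_sym_perms] sum.inter_filter[OF finite_alt_perms]
      Suc_eq_plus1[symmetric]
    using sum_rmaj_S_eq_sum_ell_S[of ?F n] sum_rmaj_A_eq_sum_ell_A[OF \<open>n \<ge> 1\<close>, of ?F]
    by (rule conjI)
qed

end
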